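(* Let $q$ be a complex number with $0<|q|<1$, fix a choice of $q^{1/8}$, and interpret every power $q^{k/8}$ ($k\in\mathbb{Z}$) as $(q^{1/8})^k$. Put $$P=\frac{f(-q)}{q^{1/8}f(-q^{4})},\qquad Q=\frac{f(-q^9)}{q^{9/8}f(-q^{36})},\qquad h=\frac{P}{Q}+\frac{Q}{P}.$$ Then $$\left(P^4Q^4+\frac{256}{P^4Q^4}\right)\left(h+1\right)=h^6-8h^5+4h^4+64h^3-16h^2-160h-96.$$
   Context: For $|x|<1$, $f(-x):=(x;x)_\infty=\prod_{n=1}^{\infty}(1-x^n)$, where $(a;x)_\infty=\prod_{n\ge 0}(1-ax^n)$. *)

theory Defs
  imports "HOL-Analysis.Analysis"
begin

definition qpoch_inf :: "complex \<Rightarrow> complex \<Rightarrow> complex" where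
  "qpoch_inf a x = (\<Prod>n. 1 - a * x ^ n)"

text \<open>
  Ramanujan's one-variable function is specified by f(-x) = (x; x)_infinity,
  hence the signs. It is meaningful for arguments of norm less than 1.
\<close>

definition ramanujan_f :: "complex \<Rightarrow> complex" where
  "ramanujan_f y = qpoch_inf (- y) (- y)"

lemma ramanujan_f_uminus: "ramanujan_f (- x) = (\<Prod>n. 1 - x ^ Suc n)"
  by (simp add: ramanujan_f_def qpoch_inf_def)

lemma convergent_prod_ramanujan_f:
  fixes x :: complex
  assumes "norm x < 1"
  shows "convergent_prod (\<lambda>n. 1 - x ^ Suc n)"
proof -
  have "summable (\<lambda>n. norm (x ^ Suc n))"
    using assms by (simp add: norm_power norm_mult summable_geometric summable_mult)
  then have "abs_convergent_prod (\<lambda>n. 1 - x ^ Suc n)"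
    by (intro summable_imp_abs_convergent_prod) simp
  then show ?thesis
    by (rule abs_convergent_prod_imp_convergent_prod)
qed

end

theory Submission
  imports Defs "HOL-Complex_Analysis.Complex_Analysis"
begin

text \<open>
  With \<open>t = r\<^sup>2\<close> (so that \<open>t\<^sup>4 = q\<close>), the Jacobi triple product gives \<open>P\<^sup>2 = 2 \<theta>\<^sub>4 / \<theta>\<^sub>2\<close>,
  where \<open>\<theta>\<^sub>2, \<theta>\<^sub>3, \<theta>\<^sub>4\<close> are the theta constants of nome \<open>q\<close>. Rearranging double series over sublattices
  yields \<open>\<theta>\<^sub>3\<^sup>4 = \<theta>\<^sub>2\<^sup>4 + \<theta>\<^sub>4\<^sup>4\<close> and the cubic identity
  \<open>\<theta>\<^sub>3(q) \<theta>\<^sub>3(q\<^sup>3) = \<theta>\<^sub>2(q) \<theta>\<^sub>2(q\<^sup>3) + \<theta>\<^sub>4(q) \<theta>\<^sub>4(q\<^sup>3)\<close>. Eliminating \<open>\<theta>\<^sub>3\<close> leaves the modular equation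
  of degree 3, \<open>P\<^sup>4 + R\<^sup>4 = P\<^sup>3 R\<^sup>3 + 4 P R\<close> with \<open>R\<close> the value of \<open>P\<close> at \<open>q\<^sup>3\<close>, up to a sign that the
  behaviour at \<open>q = 0\<close> decides. The pairs \<open>(P, R)\<close> and \<open>(R, Q)\<close> both satisfy it, and eliminating \<open>R\<close>
  gives the claim after cancelling factors that do not vanish near \<open>q = 0\<close>; analytic continuation in \<open>r\<close>
  extends it to the punctured disc.
\<close>

section \<open>Theta constants\<close>

lemma summable_on_UNIV_int_iff:
  fixes f :: "int \<Rightarrow> 'a :: banach"
  shows "f summable_on UNIV \<longleftrightarrow> (\<lambda>n. f (int n)) summable_on UNIV \<and> (\<lambda>n. f (- int n)) summable_on UNIV"
proof -
  have a: "(\<lambda>n. f (int n)) summable_on UNIV \<longleftrightarrow> f summable_on {0..}"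
    by (rule summable_on_reindex_bij_witness[of _ nat int]) auto
  have b: "(\<lambda>n. f (- int n)) summable_on UNIV \<longleftrightarrow> f summable_on {..0}"
    by (rule summable_on_reindex_bij_witness[of _ "\<lambda>n. nat (-n)" "\<lambda>n. - int n"]) auto
  have "(UNIV :: int set) = {0..} \<union> ({..0} - {0..})" by auto
  then show ?thesis unfolding a b
    by (metis Diff_disjoint subset_UNIV summable_on_Un_disjoint summable_on_subset_banach
        top_greatest Diff_subset)
qed

lemma abs_summable_theta:
  fixes q z :: complex
  assumes "norm q < 1" "q \<noteq> 0" "z \<noteq> 0"
  shows "Infinite_Sum.abs_summable_on (\<lambda>n::int. z powi n * q powi (n * n)) UNIV"
proof -
  have nat: "summable (\<lambda>n. norm (w ^ n * q ^ (n * n)))" for w :: complex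
  proof -
    \<comment> \<open>This sequence is the ratio of the norms of consecutive terms. The two halves
      of the integer series are the cases of w equal to z and to its inverse.\<close>
    have "(\<lambda>n. norm w * norm q * (norm q ^ 2) ^ n) \<longlonglongrightarrow> norm w * norm q * 0"
      using assms by (intro tendsto_intros LIMSEQ_power_zero) (simp add: abs_square_less_1)
    then have "\<forall>\<^sub>F n in sequentially. norm w * norm q * (norm q ^ 2) ^ n < 1/2"
      by (rule order_tendstoD) simp
    then obtain N where N: "\<And>n. n \<ge> N \<Longrightarrow> norm w * norm q * (norm q ^ 2) ^ n < 1/2"
      by (auto simp: eventually_sequentially)
    show ?thesis
    proof (rule summable_ratio_test)
      fix n assume "N \<le> n"
      then have "norm w * norm q * (norm q ^ 2) ^ n \<le> 1/2" using N by (simp add: less_imp_le)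
      then have "norm w * norm q * (norm q ^ 2) ^ n * norm (w ^ n * q ^ (n * n)) \<le> 1/2 * norm (w ^ n * q ^ (n * n))"
        by (rule mult_right_mono) simp
      moreover have "norm w * norm q * (norm q ^ 2) ^ n * norm (w ^ n * q ^ (n * n)) = norm (w ^ Suc n * q ^ (Suc n * Suc n))"
        by (simp add: norm_mult norm_power power_add power_mult power2_eq_square power_mult_distrib algebra_simps)
      ultimately show "norm (norm (w ^ Suc n * q ^ (Suc n * Suc n))) \<le> 1/2 * norm (norm (w ^ n * q ^ (n * n)))"
        by simp
    qed simp
  qed
  have "(\<lambda>n. norm (w ^ n * q ^ (n * n))) summable_on UNIV" for w
    by (rule summable_nonneg_imp_summable_on[OF nat]) simp
  moreover have "q powi (int n * int n) = q ^ (n * n)" for n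
    by (metis of_nat_mult power_int_of_nat)
  moreover have "z powi (- int n) = (inverse z) ^ n" for n
    by (simp add: power_int_minus power_inverse)
  ultimately show ?thesis
    by (subst summable_on_UNIV_int_iff) simp
qed

lemma infsum_product_abs:
  fixes f :: "'i \<Rightarrow> complex" and g :: "'j \<Rightarrow> complex"
  assumes f: "Infinite_Sum.abs_summable_on f A" and g: "Infinite_Sum.abs_summable_on g B"
  shows "(\<lambda>(i,j). f i * g j) summable_on A \<times> B"
    and "infsum f A * infsum g B = (\<Sum>\<^sub>\<infinity>(i,j)\<in>A \<times> B. f i * g j)"
proof -
  have "Infinite_Sum.abs_summable_on (\<lambda>(i,j). f i * g j) (A \<times> B)"
    using f g by (subst Infinite_Sum.abs_summable_on_Sigma_iff)
      (auto simp: norm_mult infsum_cmult_right' abs_mult intro!: summable_on_cmult_right summable_on_cmult_left)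
  then show s: "(\<lambda>(i,j). f i * g j) summable_on A \<times> B" by (rule abs_summable_summable)
  have "(\<Sum>\<^sub>\<infinity>(i,j)\<in>A \<times> B. f i * g j) = (\<Sum>\<^sub>\<infinity>i\<in>A. \<Sum>\<^sub>\<infinity>j\<in>B. f i * g j)"
    using s by (rule infsum_Sigma'_banach[symmetric])
  then show "infsum f A * infsum g B = (\<Sum>\<^sub>\<infinity>(i,j)\<in>A \<times> B. f i * g j)"
    by (simp add: infsum_cmult_right' infsum_cmult_left')
qed

lemma infsum_split:
  fixes f :: "'i \<Rightarrow> complex"
  assumes "f summable_on UNIV"
  shows "infsum f UNIV = infsum f {x. p x} + infsum f {x. \<not> p x}"
proof -
  have "UNIV = {x. p x} \<union> {x. \<not> p x}" by auto
  moreover have "f summable_on {x. p x}" "f summable_on {x. \<not> p x}"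
    using assms by (auto intro: summable_on_subset_banach)
  ultimately show ?thesis
    by (metis (no_types, lifting) infsum_Un_disjoint disjoint_iff mem_Collect_eq)
qed

text \<open>The classical theta constants of nome \<open>t ^ 4\<close>. With a fourth root of the
  nome as variable, the exponents (n + 1/2)^2 of theta2 become integers.\<close>

definition theta2 :: "complex \<Rightarrow> complex" where
  "theta2 t = (\<Sum>\<^sub>\<infinity>n::int. t powi ((2*n+1)*(2*n+1)))"
definition theta3 :: "complex \<Rightarrow> complex" where
  "theta3 t = (\<Sum>\<^sub>\<infinity>n::int. t powi (4*(n*n)))"
definition theta4 :: "complex \<Rightarrow> complex" where
  "theta4 t = (\<Sum>\<^sub>\<infinity>n::int. (if even n then 1 else -1) * t powi (4*(n*n)))"

text \<open>Brings the terms to the shape \<open>z powi n * q powi (n * n)\<close> of the triple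
  product with \<open>q = t ^ 4\<close>, taking z = q for theta2 and z = 1 for theta3.\<close>

lemma theta_jacobi:
  fixes t :: complex
  assumes "t \<noteq> 0"
  shows "t powi ((2*n+1)*(2*n+1)) = t * ((t^4) powi n * (t^4) powi (n*n))"
    and "t powi (4*(n*n)) = (t^4) powi (n*n)"
proof -
  have "t powi ((2*n+1)*(2*n+1)) = t powi (1 + 4*n + 4*(n*n))" by (simp add: algebra_simps)
  then show "t powi ((2*n+1)*(2*n+1)) = t * ((t^4) powi n * (t^4) powi (n*n))"
    using assms by (simp add: power_int_add power_int_power)
qed (simp add: power_int_power)

lemma theta_abs_summable:
  fixes t :: complex
  assumes "norm t < 1" "t \<noteq> 0"
  shows "Infinite_Sum.abs_summable_on (\<lambda>n::int. t powi ((2*n+1)*(2*n+1))) UNIV"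
    and "Infinite_Sum.abs_summable_on (\<lambda>n::int. t powi (4*(n*n))) UNIV"
    and "Infinite_Sum.abs_summable_on (\<lambda>n::int. (if even n then 1 else -1) * t powi (4*(n*n))) UNIV"
proof -
  have q: "norm (t^4) < 1" "t^4 \<noteq> 0" using assms by (auto simp: norm_power power_less_one_iff)
  show "Infinite_Sum.abs_summable_on (\<lambda>n::int. t powi ((2*n+1)*(2*n+1))) UNIV"
    unfolding theta_jacobi[OF assms(2)] norm_mult[of t]
    using abs_summable_theta[OF q q(2)] by (rule summable_on_cmult_right)
  show a: "Infinite_Sum.abs_summable_on (\<lambda>n::int. t powi (4*(n*n))) UNIV"
    unfolding theta_jacobi[OF assms(2)]
    using abs_summable_theta[OF q, of 1] by simp
  have "(\<lambda>n. norm ((if even n then 1 else -1) * t powi (4*(n*n)))) = (\<lambda>n::int. norm (t powi (4*(n*n))))"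
    by (auto simp: norm_mult)
  with a show "Infinite_Sum.abs_summable_on (\<lambda>n::int. (if even n then 1 else -1) * t powi (4*(n*n))) UNIV"
    by simp
qed

text \<open>The parameter covers two uses: k = 1 gives squares, k = 3 the products in the cubic
  identity.\<close>

lemma theta_products:
  assumes "norm t < 1" "t \<noteq> 0" "k > 0"
  shows "(\<lambda>(m,n). t powi (4*(m*m + int k*(n*n)))) summable_on UNIV"
    and "(\<lambda>(a,b). t powi ((2*a+1)*(2*a+1) + int k*((2*b+1)*(2*b+1)))) summable_on UNIV"
    and "theta3 t * theta3 (t^k) = (\<Sum>\<^sub>\<infinity>(m,n). t powi (4*(m*m + int k*(n*n))))"
    and "theta4 t * theta4 (t^k) = (\<Sum>\<^sub>\<infinity>(m,n). (if even (m+n) then 1 else -1) * t powi (4*(m*m + int k*(n*n))))"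
    and "theta2 t * theta2 (t^k) = (\<Sum>\<^sub>\<infinity>(a,b). t powi ((2*a+1)*(2*a+1) + int k*((2*b+1)*(2*b+1))))"
proof -
  have tk: "norm (t^k) < 1" "t^k \<noteq> 0" using assms by (auto simp: norm_power power_less_one_iff)
  have e3: "t powi (4*(m*m)) * (t^k) powi (4*(n*n)) = t powi (4*(m*m + int k*(n*n)))" for m n
    using assms by (simp add: power_int_power power_int_add algebra_simps)
  have e2: "t powi ((2*a+1)*(2*a+1)) * (t^k) powi ((2*b+1)*(2*b+1)) = t powi ((2*a+1)*(2*a+1) + int k*((2*b+1)*(2*b+1)))" for a b
    unfolding power_int_power using assms by (subst power_int_add) auto
  note s = theta_abs_summable[OF assms(1,2)] and sk = theta_abs_summable[OF tk]
  show "(\<lambda>(m,n). t powi (4*(m*m + int k*(n*n)))) summable_on UNIV"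
    using infsum_product_abs(1)[OF s(2) sk(2)] by (simp add: e3)
  show "(\<lambda>(a,b). t powi ((2*a+1)*(2*a+1) + int k*((2*b+1)*(2*b+1)))) summable_on UNIV"
    using infsum_product_abs(1)[OF s(1) sk(1)] unfolding e2 by simp
  show "theta3 t * theta3 (t^k) = (\<Sum>\<^sub>\<infinity>(m,n). t powi (4*(m*m + int k*(n*n))))"
    using infsum_product_abs(2)[OF s(2) sk(2)] by (simp add: e3 theta3_def)
  show "theta2 t * theta2 (t^k) = (\<Sum>\<^sub>\<infinity>(a,b). t powi ((2*a+1)*(2*a+1) + int k*((2*b+1)*(2*b+1))))"
    using infsum_product_abs(2)[OF s(1) sk(1)] unfolding e2 theta2_def by simp
  have e4: "(if even m then 1 else -1) * t powi (4*(m*m)) * ((if even n then 1 else -1) * (t^k) powi (4*(n*n)))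
      = (if even (m+n) then 1 else -1) * t powi (4*(m*m + int k*(n*n)))" for m n
    using e3[of m n] by auto
  show "theta4 t * theta4 (t^k) = (\<Sum>\<^sub>\<infinity>(m,n). (if even (m+n) then 1 else -1) * t powi (4*(m*m + int k*(n*n))))"
    using infsum_product_abs(2)[OF s(3) sk(3)] unfolding e4 theta4_def by simp
qed

text \<open>The sign in the theta4 product depends only on the parity of m + n, so both products are
  built from the same two half-lattice sums.\<close>

lemma theta34_split:
  assumes "norm t < 1" "t \<noteq> 0" "k > 0"
  defines "F \<equiv> (\<lambda>(m,n). t powi (4*(m*m + int k*(n*n))))"
  shows "theta3 t * theta3 (t^k) = infsum F {(m,n). even (m+n)} + infsum F {(m,n). odd (m+n)}"
    and "theta4 t * theta4 (t^k) = infsum F {(m,n). even (m+n)} - infsum F {(m,n). odd (m+n)}"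
proof -
  have s: "F summable_on UNIV" unfolding F_def using assms(1-3) by (rule theta_products)
  show 3: "theta3 t * theta3 (t^k) = infsum F {(m,n). even (m+n)} + infsum F {(m,n). odd (m+n)}"
    using infsum_split[OF s, of "\<lambda>(m,n). even (m+n)"] theta_products(3)[OF assms(1-3)]
    by (simp add: F_def case_prod_unfold)
  let ?G = "\<lambda>(m,n). (if even (m+n) then 1 else -1) * t powi (4*(m*m + int k*(n*n)))"
  have ev: "infsum ?G {(m,n). even (m+n)} = infsum F {(m,n). even (m+n)}"
    by (intro infsum_cong) (auto simp: F_def)
  have od: "infsum ?G {(m,n). odd (m+n)} = infsum (\<lambda>x. - F x) {(m,n). odd (m+n)}"
    by (intro infsum_cong) (auto simp: F_def)
  have sub: "F summable_on A" for A using s by (rule summable_on_subset_banach) simp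
  have se: "?G summable_on {(m,n). even (m+n)}"
    by (rule summable_on_cong[THEN iffD1, OF _ sub]) (auto simp: F_def)
  have so: "?G summable_on {(m,n). odd (m+n)}"
    by (rule summable_on_cong[THEN iffD1, OF _ summable_on_uminus[THEN iffD2, OF sub]]) (auto simp: F_def)
  have u: "UNIV = {(m::int,n). even (m+n)} \<union> {(m,n). odd (m+n)}" by auto
  show "theta4 t * theta4 (t^k) = infsum F {(m,n). even (m+n)} - infsum F {(m,n). odd (m+n)}"
    unfolding theta_products(4)[OF assms(1-3)] u
    by (subst infsum_Un_disjoint[OF se so]) (auto simp only: ev od infsum_uminus, auto)
qed

section \<open>Theta identities from changes of lattice coordinates\<close>

text \<open>Parametrizing a parity class by free integers lets the simplifier evaluate the
  \<open>div 2\<close> in the index changes below; the next two lemmas serve the same end.\<close>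

lemma even_diffE:
  fixes x :: "int \<times> int"
  assumes "x \<in> {(a,b). even (a-b)}"
  obtains b c where "x = (b+2*c,b)"
proof -
  obtain a b where x: "x = (a,b)" by (cases x)
  with assms have "even (a-b)" by simp
  then obtain c where "a - b = 2*c" by (rule evenE)
  then have "x = (b+2*c,b)" using x by simp
  then show thesis by (rule that)
qed

lemma even_addE:
  fixes x :: "int \<times> int"
  assumes "x \<in> {(m,n). even (m+n)}"
  obtains n c where "x = (2*c-n,n)"
proof -
  obtain m n where x: "x = (m,n)" by (cases x)
  with assms have "even (m+n)" by simp
  then obtain c where "m + n = 2*c" by (rule evenE)
  then have "x = (2*c-n,n)" using x by simp
  then show thesis by (rule that)
qed

lemma odd_addE:
  fixes x :: "int \<times> int"
  assumes "x \<in> {(m,n). odd (m+n)}"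
  obtains n c where "x = (2*c+1-n,n)"
proof -
  obtain m n where x: "x = (m,n)" by (cases x)
  with assms have "odd (m+n)" by simp
  then obtain c where "m + n = 2*c+1" by (rule oddE)
  then have "x = (2*c+1-n,n)" using x by simp
  then show thesis by (rule that)
qed

text \<open>
  The exponents are norms \<open>x\<^sup>2 + 3 y\<^sup>2\<close> in the Eisenstein lattice; the witnesses in the first step are the
  rotation by a sixth of a turn (up to a reflection), which maps the pairs of odd integers with \<open>x \<equiv> y\<close> modulo 4 to those
  \<open>2 (m, n)\<close> with \<open>m + n\<close> odd.
\<close>

lemma theta_cubic:
  assumes "norm t < 1" "t \<noteq> 0"
  shows "theta3 t * theta3 (t^3) = theta2 t * theta2 (t^3) + theta4 t * theta4 (t^3)"
proof -
  have [simp]: "- (2*n) div 2 = - n" for n :: int by presburger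
  let ?F = "\<lambda>(m,n). t powi (4*(m*m + int 3*(n*n)))"
  let ?G = "\<lambda>(a,b). t powi ((2*a+1)*(2*a+1) + int 3*((2*b+1)*(2*b+1)))"
  have e: "infsum ?G {(a,b). even (a-b)} = infsum ?F {(m,n). odd (m+n)}"
  proof (rule infsum_reindex_bij_witness[of _ "\<lambda>(m,n). ((m+3*n-1) div 2, (m-n-1) div 2)" "\<lambda>(a,b). ((a+3*b+2) div 2, (a-b) div 2)"], goal_cases)
    case (1 x)
    then obtain b c where "x = (b+2*c,b)" by (rule even_diffE)
    then show ?case by (auto simp: algebra_simps)
  next
    case (2 x)
    then obtain b c where "x = (b+2*c,b)" by (rule even_diffE)
    then show ?case by auto
  next
    case (3 x)
    then obtain n c where "x = (2*c+1-n,n)" by (rule odd_addE)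
    then show ?case by (auto simp: algebra_simps)
  next
    case (4 x)
    then obtain n c where "x = (2*c+1-n,n)" by (rule odd_addE)
    then show ?case by auto
  next
    case (5 x)
    then obtain b c where "x = (b+2*c,b)" by (rule even_diffE)
    then show ?case by (auto simp: algebra_simps intro!: arg_cong[where f="power_int t"])
  qed
  \<comment> \<open>Replacing b by -1-b negates 2b+1, hence keeps the exponent, but flips the parity
    of a - b.\<close>
  have o: "infsum ?G {(a,b). odd (a-b)} = infsum ?G {(a,b). even (a-b)}"
    by (rule infsum_reindex_bij_witness[of _ "\<lambda>(a,b). (a,-1-b)" "\<lambda>(a,b). (a,-1-b)"])
       (auto simp: algebra_simps)
  have "theta2 t * theta2 (t^3) = infsum ?G {(a,b). even (a-b)} + infsum ?G {(a,b). odd (a-b)}"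
    using infsum_split[OF theta_products(2)[OF assms, of 3], of "\<lambda>(a,b). even (a-b)"] theta_products(5)[OF assms, of 3]
    by (simp add: case_prod_unfold)
  \<comment> \<open>Twice the odd half-lattice sum is also the theta3 product minus the theta4
    product.\<close>
  then have "theta2 t * theta2 (t^3) = 2 * infsum ?F {(m,n). odd (m+n)}"
    unfolding o e by simp
  then show ?thesis
    using theta34_split[OF assms, of 3] by simp
qed

text \<open>Passing to sum and difference of coordinates doubles the form x^2 + y^2. It carries the
  lattice sums at \<open>t^2\<close> onto the even and odd half-lattices at t, and splits the sum
  over pairs of odd integers into two equal halves.\<close>

lemma theta_duplication:
  assumes "norm t < 1" "t \<noteq> 0"
  shows "theta3 t ^ 2 = theta3 (t^2) ^ 2 + theta2 (t^2) ^ 2"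
    and "theta4 t ^ 2 = theta3 (t^2) ^ 2 - theta2 (t^2) ^ 2"
    and "theta2 t ^ 2 = 2 * theta2 (t^2) * theta3 (t^2)"
proof -
  let ?F = "\<lambda>(m,n). t powi (4*(m*m + int 1*(n*n)))"
  have t2: "norm (t^2) < 1" "t^2 \<noteq> 0" using assms by (auto simp: norm_power power_less_one_iff)
  have e: "theta3 (t^2) ^ 2 = infsum ?F {(m,n). even (m+n)}"
  proof -
    have "theta3 (t^2) ^ 2 = (\<Sum>\<^sub>\<infinity>(m,n). (t^2) powi (4*(m*m + n*n)))"
      using theta_products(3)[OF t2, of 1] by (simp add: power2_eq_square)
    also have "\<dots> = infsum ?F {(m,n). even (m+n)}"
    proof (rule infsum_reindex_bij_witness[of _ "\<lambda>(m,n). ((m+n) div 2, (m-n) div 2)" "\<lambda>(a,b). (a+b, a-b)"], goal_cases)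
      case (3 x)
      then obtain n c where "x = (2*c-n,n)" by (rule even_addE)
      then show ?case by auto
    next
      case (5 x) then show ?case
        by (auto simp: case_prod_unfold power_int_power algebra_simps intro!: arg_cong[where f="power_int t"])
    qed auto
    finally show ?thesis .
  qed
  have o: "theta2 (t^2) ^ 2 = infsum ?F {(m,n). odd (m+n)}"
  proof -
    have "theta2 (t^2) ^ 2 = (\<Sum>\<^sub>\<infinity>(a,b). (t^2) powi ((2*a+1)*(2*a+1) + (2*b+1)*(2*b+1)))"
      using theta_products(5)[OF t2, of 1] by (simp add: power2_eq_square)
    also have "\<dots> = infsum ?F {(m,n). odd (m+n)}"
    proof (rule infsum_reindex_bij_witness[of _ "\<lambda>(m,n). ((m+n-1) div 2, (m-n-1) div 2)" "\<lambda>(a,b). (a+b+1, a-b)"], goal_cases)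
      case (3 x)
      then obtain n c where "x = (2*c+1-n,n)" by (rule odd_addE)
      then show ?case by auto
    next
      case (5 x) then show ?case
        by (auto simp: case_prod_unfold power_int_power algebra_simps intro!: arg_cong[where f="power_int t"])
    qed auto
    finally show ?thesis .
  qed
  show "theta3 t ^ 2 = theta3 (t^2) ^ 2 + theta2 (t^2) ^ 2"
    and "theta4 t ^ 2 = theta3 (t^2) ^ 2 - theta2 (t^2) ^ 2"
    using theta34_split[OF assms, of 1] unfolding e o by (simp_all add: power2_eq_square)
  let ?G = "\<lambda>(a,b). t powi ((2*a+1)*(2*a+1) + int 1*((2*b+1)*(2*b+1)))"
  have prod: "theta2 (t^2) * theta3 (t^2) = (\<Sum>\<^sub>\<infinity>(c,d). (t^2) powi ((2*c+1)*(2*c+1)) * (t^2) powi (4*(d*d)))"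
    unfolding theta2_def theta3_def
    using infsum_product_abs(2)[OF theta_abs_summable(1,2)[OF t2]] by simp
  have prod': "(t^2) powi ((2*c+1)*(2*c+1)) * (t^2) powi (4*(d*d)) = t powi (2*((2*c+1)*(2*c+1)) + 8*(d*d))" for c d
    unfolding power_int_power using assms by (subst power_int_add) (auto simp: algebra_simps)
  have ge: "infsum ?G {(a,b). even (a-b)} = theta2 (t^2) * theta3 (t^2)"
    unfolding prod prod'
  proof (rule infsum_reindex_bij_witness[of _ "\<lambda>(c,d). (c+d, c-d)" "\<lambda>(a,b). ((a+b) div 2, (a-b) div 2)"], goal_cases)
    case (1 x)
    then obtain b c where "x = (b+2*c,b)" by (rule even_diffE)
    then show ?case by auto
  next
    case (5 x)
    then obtain b c where "x = (b+2*c,b)" by (rule even_diffE)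
    then show ?case by (auto simp: algebra_simps intro!: arg_cong[where f="power_int t"])
  qed auto
  have go: "infsum ?G {(a,b). odd (a-b)} = infsum ?G {(a,b). even (a-b)}"
    by (rule infsum_reindex_bij_witness[of _ "\<lambda>(a,b). (a,-1-b)" "\<lambda>(a,b). (a,-1-b)"])
       (auto simp: algebra_simps)
  have "theta2 t * theta2 (t^1) = infsum ?G {(a,b). even (a-b)} + infsum ?G {(a,b). odd (a-b)}"
    using infsum_split[OF theta_products(2)[OF assms, of 1], of "\<lambda>(a,b). even (a-b)"] theta_products(5)[OF assms, of 1]
    by (simp add: case_prod_unfold)
  then show "theta2 t ^ 2 = 2 * theta2 (t^2) * theta3 (t^2)"
    unfolding go ge by (simp add: power2_eq_square[of "theta2 t"])
qed

text \<open>With a and b the squares of theta3 and theta2 at \<open>t^2\<close>, duplication reduces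
  this to (a + b)^2 = 4 a b + (a - b)^2.\<close>

lemma theta_quartic:
  assumes "norm t < 1" "t \<noteq> 0"
  shows "theta3 t ^ 4 = theta2 t ^ 4 + theta4 t ^ 4"
proof -
  have "x ^ 4 = (x^2)^2" for x :: complex by simp
  then show ?thesis
    unfolding theta_duplication[OF assms] \<open>\<And>x. x ^ 4 = (x^2)^2\<close>
    by (simp add: power2_eq_square algebra_simps)
qed

section \<open>The Jacobi triple product\<close>

text \<open>By the Weierstrass M-test the finite partial sums converge uniformly in N, which permits
  exchanging the two limits.\<close>

lemma infsum_dominated_convergence:
  fixes a :: "nat \<Rightarrow> 'i \<Rightarrow> complex"
  assumes lim: "\<And>i. (\<lambda>N. a N i) \<longlonglongrightarrow> b i"
    and bound: "\<And>N i. norm (a N i) \<le> M i" and M: "M summable_on UNIV"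
  shows "(\<lambda>N. infsum (a N) UNIV) \<longlonglongrightarrow> infsum b UNIV"
proof (rule swap_uniform_limit')
  show "uniform_limit UNIV (\<lambda>X N. \<Sum>i\<in>X. a N i) (\<lambda>N. infsum (a N) UNIV) (finite_subsets_at_top UNIV)"
    using bound M by (intro Weierstrass_m_test_general) auto
  show "\<forall>\<^sub>F X in finite_subsets_at_top UNIV. (\<lambda>N. \<Sum>i\<in>X. a N i) \<longlonglongrightarrow> (\<Sum>i\<in>X. b i)"
    by (intro always_eventually allI tendsto_sum lim)
  have b: "norm (b i) \<le> M i" for i
    by (rule LIMSEQ_le_const2[OF tendsto_norm[OF lim]]) (use bound in auto)
  have "b summable_on UNIV"
    by (rule abs_summable_summable, rule Infinite_Sum.abs_summable_on_comparison_test'[OF M b])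
  from has_sum_infsum[OF this] show "(sum b \<longlongrightarrow> infsum b UNIV) (finite_subsets_at_top UNIV)"
    unfolding has_sum_def .
qed auto

section \<open>Euler products and their reciprocals\<close>

lemma ramanujan_f_LIMSEQ:
  assumes "norm x < 1"
  shows "(\<lambda>N. \<Prod>k<N. 1 - x ^ Suc k) \<longlonglongrightarrow> ramanujan_f (- x)"
  using convergent_prod_LIMSEQ[OF convergent_prod_ramanujan_f[OF assms]]
  unfolding LIMSEQ_lessThan_iff_atMost ramanujan_f_uminus .

lemma one_minus_power_Suc_nonzero:
  fixes x :: complex
  assumes "norm x < 1"
  shows "1 - x ^ Suc k \<noteq> 0"
proof -
  have "norm (x ^ Suc k) < 1" using assms by (simp only: norm_power power_Suc_less_one norm_ge_zero power_less_one_iff zero_less_Suc)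
  then show ?thesis by (metis norm_one order.irrefl right_minus_eq)
qed

lemma ramanujan_f_nonzero:
  assumes "norm x < 1"
  shows "ramanujan_f (- x) \<noteq> 0"
  unfolding ramanujan_f_uminus
  using convergent_prod_ramanujan_f[OF assms] one_minus_power_Suc_nonzero[OF assms]
  by (rule prodinf_nonzero)

text \<open>
  The value 0 at negative arguments makes the recurrence \<open>inv_qpoch_pred\<close> hold for all integers, so that
  the finite triple product below can be summed over all of \<open>\<int>\<close> without boundary terms.
\<close>

definition inv_qpoch :: "complex \<Rightarrow> int \<Rightarrow> complex" where
  "inv_qpoch x k = (if k < 0 then 0 else inverse (\<Prod>j<nat k. 1 - x ^ Suc j))"

lemma inv_qpoch_pred:
  assumes "norm x < 1" "x \<noteq> 0"
  shows "inv_qpoch x (k - 1) = (1 - x powi k) * inv_qpoch x k"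
proof (cases "k > 0")
  case True
  then obtain n where n: "k = int (Suc n)" by (metis gr0_implies_Suc zero_less_imp_eq_int)
  have "x powi k = x ^ Suc n" unfolding n by (rule power_int_of_nat)
  then show ?thesis
    using one_minus_power_Suc_nonzero[OF assms(1), of n] by (simp add: inv_qpoch_def n nat_add_distrib del: power_Suc)
next
  case False
  \<comment> \<open>The left side is 0 by convention; on the right, 1 - x^0 vanishes for k = 0 and
    \<open>inv_qpoch x k\<close> for k < 0.\<close>
  then show ?thesis by (cases "k = 0") (auto simp: inv_qpoch_def)
qed

lemma inv_qpoch_LIMSEQ:
  assumes "norm x < 1"
  shows "(\<lambda>N. inv_qpoch x (int N + k)) \<longlonglongrightarrow> inverse (ramanujan_f (- x))"
proof -
  have "(\<lambda>N. inv_qpoch x (int N)) \<longlonglongrightarrow> inverse (ramanujan_f (- x))"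
    using tendsto_inverse[OF ramanujan_f_LIMSEQ ramanujan_f_nonzero] assms by (simp add: inv_qpoch_def)
  moreover have "filterlim (\<lambda>N. nat (int N + k)) sequentially sequentially"
    unfolding filterlim_at_top
  proof
    fix Z show "\<forall>\<^sub>F N in sequentially. Z \<le> nat (int N + k)"
      using eventually_ge_at_top[of "nat (int Z - k)"] by eventually_elim auto
  qed
  ultimately have "(\<lambda>N. inv_qpoch x (int (nat (int N + k)))) \<longlonglongrightarrow> inverse (ramanujan_f (- x))"
    by (rule filterlim_compose)
  moreover have "\<forall>\<^sub>F N in sequentially. inv_qpoch x (int (nat (int N + k))) = inv_qpoch x (int N + k)"
    using eventually_ge_at_top[of "nat (- k)"] by eventually_elim auto
  ultimately show ?thesis by (rule Lim_transform_eventually)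
qed

lemma inv_qpoch_bounded:
  assumes "norm x < 1"
  obtains C where "\<And>k. norm (inv_qpoch x k) \<le> C" "C > 0"
proof -
  have "convergent (\<lambda>N. inv_qpoch x (int N + 0))"
    using inv_qpoch_LIMSEQ[OF assms, of 0] by (rule convergentI)
  then have "Bseq (\<lambda>N. inv_qpoch x (int N))" by (simp add: convergent_imp_Bseq)
  then obtain C where C: "C > 0" "\<And>N. norm (inv_qpoch x (int N)) \<le> C" by (auto elim: BseqE)
  have "norm (inv_qpoch x k) \<le> C" for k
    using C(2)[of "nat k"] C(1) by (cases "k < 0") (auto simp: inv_qpoch_def)
  with C(1) show thesis by (rule that[rotated])
qed

section \<open>The finite triple product and its limit\<close>

text \<open>The algebra behind \<open>jtp_term_rec\<close>, with u = q^2, A = u^(N-n), B = u^(N+n),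
  and X, Y the values of \<open>inv_qpoch\<close> at N+1-n and N+1+n. The left side belongs to index
  n at N+1, the three summands to n, n-1 and n+1 at N.\<close>

lemma jtp_algebra:
  fixes A B u X Y w :: complex
  shows "(1 - A * B * u) * (1 - A * B * u * u) * (X * Y * w) =
    (1 + A * B * u) * ((1 - A * u) * X * ((1 - B * u) * Y) * w)
    + X * ((1 - B) * ((1 - B * u) * Y)) * (A * u * w)
    + (1 - A) * ((1 - A * u) * X) * Y * (B * u * w)"
proof -
  have "(1 - A * B * u) * (1 - A * B * u * u) =
    (1 + A * B * u) * ((1 - A * u) * (1 - B * u)) + (1 - B) * (1 - B * u) * (A * u) + (1 - A) * (1 - A * u) * (B * u)"
    by (simp add: algebra_simps)
  from arg_cong[OF this, of "\<lambda>v. v * (X * Y * w)"] show ?thesis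
    by (simp only: distrib_right distrib_left mult_ac)
qed

lemma infsum_shift_int:
  fixes f :: "int \<Rightarrow> complex"
  shows "(\<Sum>\<^sub>\<infinity>n. f (n + k)) = infsum f UNIV"
  by (rule infsum_reindex_bij_witness[of _ "\<lambda>n. n - k" "\<lambda>n. n + k"]) auto

lemma summable_on_shift_int:
  fixes f :: "int \<Rightarrow> complex"
  shows "(\<lambda>n. f (n + k)) summable_on UNIV \<longleftrightarrow> f summable_on UNIV"
  by (rule summable_on_reindex_bij_witness[of _ "\<lambda>n. n - k" "\<lambda>n. n + k"]) auto

lemma norm_power2_less_one:
  fixes q :: complex
  assumes "norm q < 1" "q \<noteq> 0"
  shows "norm (q\<^sup>2) < 1" "q\<^sup>2 \<noteq> 0"
  using assms by (auto simp: norm_power abs_square_less_1)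

context
  fixes q z :: complex
  assumes q: "norm q < 1" "q \<noteq> 0" and z: "z \<noteq> 0"
begin

lemmas q2 = norm_power2_less_one[OF q]

text \<open>Up to the factor (q^2; q^2)_{2N}, which does not depend on n, this is the Gaussian
  binomial coefficient of 2N over N+n in base q^2 times z^n q^(n^2). It vanishes for |n| >
  N.\<close>

definition jtp_term :: "nat \<Rightarrow> int \<Rightarrow> complex" where
  "jtp_term N n = inv_qpoch (q\<^sup>2) (int N - n) * inv_qpoch (q\<^sup>2) (int N + n) * (z powi n * q powi (n * n))"

text \<open>The constant is uniform in N, so the bound also serves as majorant when N tends to
  infinity.\<close>

lemma jtp_term_bound:
  obtains C where "\<And>N n. norm (jtp_term N n) \<le> C * norm (z powi n * q powi (n * n))"
proof -
  obtain C where C: "\<And>k. norm (inv_qpoch (q\<^sup>2) k) \<le> C" "C > 0"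
    using inv_qpoch_bounded[OF q2(1)] by blast
  have "norm (jtp_term N n) \<le> (C * C) * norm (z powi n * q powi (n * n))" for N n
    unfolding jtp_term_def norm_mult[of "_ * _" "z powi n * q powi (n * n)"] norm_mult[of "inv_qpoch _ _"]
    using C by (intro mult_right_mono mult_mono) auto
  then show thesis by (rule that)
qed

lemma jtp_term_summable: "jtp_term N summable_on UNIV"
proof -
  obtain C where C: "\<And>N n. norm (jtp_term N n) \<le> C * norm (z powi n * q powi (n * n))"
    using jtp_term_bound by blast
  have M: "(\<lambda>n. C * norm (z powi n * q powi (n * n))) summable_on UNIV"
    by (rule summable_on_cmult_right[OF abs_summable_theta[OF q z]])
  show ?thesis
    by (rule abs_summable_summable, rule Infinite_Sum.abs_summable_on_comparison_test'[OF M C])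
qed

text \<open>The coefficients on the right are those of (1 + z x)(1 + x/z) expanded in z, where x =
  q^(2N+1) is the next odd power.\<close>

lemma jtp_term_rec:
  "(1 - q ^ (4*N+2)) * (1 - q ^ (4*N+4)) * jtp_term (Suc N) n =
   (1 + q ^ (4*N+2)) * jtp_term N n + q ^ (2*N+1) * z * jtp_term N (n + (-1)) + q ^ (2*N+1) / z * jtp_term N (n + 1)"
proof -
  define A where "A = (q\<^sup>2) powi (int N - n)"
  define B where "B = (q\<^sup>2) powi (int N + n)"
  define X where "X = inv_qpoch (q\<^sup>2) (int N + 1 - n)"
  define Y where "Y = inv_qpoch (q\<^sup>2) (int N + 1 + n)"
  define w where "w = z powi n * q powi (n * n)"
  have A1: "(q\<^sup>2) powi (int N - n + 1) = A * q\<^sup>2" and B1: "(q\<^sup>2) powi (int N + n + 1) = B * q\<^sup>2"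
    using q2(2) by (simp_all add: A_def B_def power_int_add)
  have X0: "inv_qpoch (q\<^sup>2) (int N - n) = (1 - A * q\<^sup>2) * X"
    using inv_qpoch_pred[OF q2, of "int N - n + 1"] unfolding A1 by (simp add: X_def algebra_simps)
  have X1: "inv_qpoch (q\<^sup>2) (int N - (n + 1)) = (1 - A) * ((1 - A * q\<^sup>2) * X)"
    using inv_qpoch_pred[OF q2, of "int N - n"] unfolding A_def[symmetric] X0 by (simp add: algebra_simps)
  have Y0: "inv_qpoch (q\<^sup>2) (int N + n) = (1 - B * q\<^sup>2) * Y"
    using inv_qpoch_pred[OF q2, of "int N + n + 1"] unfolding B1 by (simp add: Y_def algebra_simps)
  have Y1: "inv_qpoch (q\<^sup>2) (int N + (n + (-1))) = (1 - B) * ((1 - B * q\<^sup>2) * Y)"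
    using inv_qpoch_pred[OF q2, of "int N + n"] unfolding B_def[symmetric] Y0 by (simp add: algebra_simps)
  have AB: "A * B = q ^ (4*N)"
  proof -
    have "A * B = (q\<^sup>2) powi (int (2*N))"
      unfolding A_def B_def using q2(2) by (subst power_int_add[symmetric]) auto
    also have "\<dots> = q ^ (4*N)" unfolding power_int_of_nat by (simp add: power_mult[symmetric])
    finally show ?thesis .
  qed
  have w1: "q ^ (2*N+1) / z * (z powi (n + 1) * q powi ((n + 1) * (n + 1))) = B * q\<^sup>2 * w"
  proof -
    have "q ^ (2*N+1) * q powi ((n + 1) * (n + 1)) = q powi (int (2*N+1) + (n + 1) * (n + 1))"
      using power_int_add[OF disjI1[OF q(2)], of "int (2*N+1)" "(n + 1) * (n + 1)"] by (simp only: power_int_of_nat)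
    also have "\<dots> = q powi (2 * (int N + n) + 2 + n * n)" by (simp add: algebra_simps)
    also have "\<dots> = B * q\<^sup>2 * q powi (n * n)"
      using q by (simp add: B_def power_int_add power_int_power)
    finally have 1: "q ^ (2*N+1) * q powi ((n + 1) * (n + 1)) = B * q\<^sup>2 * q powi (n * n)" .
    have 2: "z powi (n + 1) / z = z powi n" using z by (simp add: power_int_add)
    have "q ^ (2*N+1) / z * (z powi (n + 1) * q powi ((n + 1) * (n + 1)))
        = (z powi (n + 1) / z) * (q ^ (2*N+1) * q powi ((n + 1) * (n + 1)))" by (simp only: mult_ac times_divide_eq_left times_divide_eq_right)
    then show ?thesis unfolding 1 2 w_def by (simp only: mult_ac)
  qed
  have w2: "q ^ (2*N+1) * z * (z powi (n + (-1)) * q powi ((n + (-1)) * (n + (-1)))) = A * q\<^sup>2 * w"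
  proof -
    have "q ^ (2*N+1) * q powi ((n + (-1)) * (n + (-1))) = q powi (int (2*N+1) + (n + (-1)) * (n + (-1)))"
      using power_int_add[OF disjI1[OF q(2)], of "int (2*N+1)" "(n + (-1)) * (n + (-1))"] by (simp only: power_int_of_nat)
    also have "\<dots> = q powi (2 * (int N - n) + 2 + n * n)" by (simp add: algebra_simps)
    also have "\<dots> = A * q\<^sup>2 * q powi (n * n)"
      using q by (simp add: A_def power_int_add power_int_power power_int_diff)
    finally have 1: "q ^ (2*N+1) * q powi ((n + (-1)) * (n + (-1))) = A * q\<^sup>2 * q powi (n * n)" .
    have 2: "z * z powi (n + (-1)) = z powi n" using z power_int_minus_mult[of z n] by (simp add: mult.commute)
    have "q ^ (2*N+1) * z * (z powi (n + (-1)) * q powi ((n + (-1)) * (n + (-1))))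
        = (z * z powi (n + (-1))) * (q ^ (2*N+1) * q powi ((n + (-1)) * (n + (-1))))" by (simp only: mult_ac)
    then show ?thesis unfolding 1 2 w_def by (simp only: mult_ac)
  qed
  have "jtp_term (Suc N) n = X * Y * w"
    by (simp add: jtp_term_def X_def Y_def w_def algebra_simps)
  moreover have "jtp_term N n = (1 - A * q\<^sup>2) * X * ((1 - B * q\<^sup>2) * Y) * w"
    by (simp add: jtp_term_def X0 Y0 w_def)
  moreover have "q ^ (2*N+1) * z * jtp_term N (n + (-1)) = X * ((1 - B) * ((1 - B * q\<^sup>2) * Y)) * (A * q\<^sup>2 * w)"
  proof -
    have "inv_qpoch (q\<^sup>2) (int N - (n + (-1))) = X" by (simp add: X_def algebra_simps)
    then show ?thesis unfolding jtp_term_def Y1 w2[symmetric] by (simp add: mult_ac)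
  qed
  moreover have "q ^ (2*N+1) / z * jtp_term N (n + 1) = (1 - A) * ((1 - A * q\<^sup>2) * X) * Y * (B * q\<^sup>2 * w)"
  proof -
    have "inv_qpoch (q\<^sup>2) (int N + (n + 1)) = Y" by (simp add: Y_def algebra_simps)
    then show ?thesis unfolding jtp_term_def X1 w1[symmetric] by (simp add: mult_ac)
  qed
  moreover have "q ^ (4*N+2) = A * B * q\<^sup>2" "q ^ (4*N+4) = A * B * q\<^sup>2 * q\<^sup>2"
    by (simp_all add: AB power_add eval_nat_numeral)
  ultimately show ?thesis by (simp only: jtp_algebra)
qed

text \<open>Summing the recurrence over all integers makes the shifts of n disappear, so the three
  sums on the right coincide and the next factor of the product splits off.\<close>

lemma finite_jtp:
  "(\<Prod>k<2*N. 1 - (q\<^sup>2) ^ Suc k) * infsum (jtp_term N) UNIV = (\<Prod>k<N. (1 + z * q ^ (2*k+1)) * (1 + q ^ (2*k+1) / z))"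
proof (induction N)
  case 0
  have "jtp_term 0 n = (if n = 0 then 1 else 0)" for n
    by (auto simp: jtp_term_def inv_qpoch_def)
  then have "infsum (jtp_term 0) UNIV = infsum (\<lambda>_. 1) {0::int}"
    by (intro infsum_cong_neutral) auto
  then show ?case by simp
next
  case (Suc N)
  let ?J = "\<lambda>N. infsum (jtp_term N) UNIV"
  have s: "(\<lambda>n. c * jtp_term N (n + k)) summable_on UNIV" for c k
    by (intro summable_on_cmult_right) (simp add: summable_on_shift_int[of "jtp_term N"] jtp_term_summable)
  have i: "(\<Sum>\<^sub>\<infinity>n. c * jtp_term N (n + k)) = c * ?J N" for c k
    by (simp add: infsum_cmult_right' infsum_shift_int[of "jtp_term N"])
  have "(1 - q ^ (4*N+2)) * (1 - q ^ (4*N+4)) * ?J (Suc N)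
      = (\<Sum>\<^sub>\<infinity>n. (1 - q ^ (4*N+2)) * (1 - q ^ (4*N+4)) * jtp_term (Suc N) n)"
    by (simp add: infsum_cmult_right')
  also have "\<dots> = (\<Sum>\<^sub>\<infinity>n. (1 + q ^ (4*N+2)) * jtp_term N (n + 0) + q ^ (2*N+1) * z * jtp_term N (n + (-1))
      + q ^ (2*N+1) / z * jtp_term N (n + 1))"
    unfolding jtp_term_rec by simp
  also have "\<dots> = (1 + q ^ (4*N+2)) * ?J N + q ^ (2*N+1) * z * ?J N + q ^ (2*N+1) / z * ?J N"
    using s by (subst infsum_add, (intro summable_on_add s)+)+ (simp only: i)
  also have "\<dots> = (1 + z * q ^ (2*N+1)) * (1 + q ^ (2*N+1) / z) * ?J N"
  proof -
    have "q ^ (4*N+2) = q ^ (2*N+1) * q ^ (2*N+1)" by (simp add: power_add[symmetric])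
    moreover have "(1 + x * x) * J + x * z * J + x / z * J = (1 + z * x) * (1 + x / z) * J" for x J
      using z by (simp add: field_simps)
    ultimately show ?thesis by (simp only:)
  qed
  finally have rec: "(1 - q ^ (4*N+2)) * (1 - q ^ (4*N+4)) * ?J (Suc N) = (1 + z * q ^ (2*N+1)) * (1 + q ^ (2*N+1) / z) * ?J N" .
  have "(q\<^sup>2) ^ Suc (2*N) = q ^ (4*N+2)" "(q\<^sup>2) ^ Suc (Suc (2*N)) = q ^ (4*N+4)"
    by (rule trans[OF power_mult[symmetric]], rule arg_cong[where f="power q"], simp)+
  then have "(\<Prod>k<2 * Suc N. 1 - (q\<^sup>2) ^ Suc k) = (\<Prod>k<2*N. 1 - (q\<^sup>2) ^ Suc k) * ((1 - q ^ (4*N+2)) * (1 - q ^ (4*N+4)))"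
    by (simp only: mult_Suc_right add_2_eq_Suc prod.lessThan_Suc mult.assoc)
  then have "(\<Prod>k<2 * Suc N. 1 - (q\<^sup>2) ^ Suc k) * ?J (Suc N) = (\<Prod>k<2*N. 1 - (q\<^sup>2) ^ Suc k) * ((1 + z * q ^ (2*N+1)) * (1 + q ^ (2*N+1) / z) * ?J N)"
    by (simp only: mult.assoc rec[unfolded mult.assoc])
  also have "\<dots> = (\<Prod>k<2*N. 1 - (q\<^sup>2) ^ Suc k) * ?J N * ((1 + z * q ^ (2*N+1)) * (1 + q ^ (2*N+1) / z))"
    by (simp only: mult_ac)
  finally show ?case unfolding Suc.IH by (simp only: prod.lessThan_Suc)
qed

text \<open>In the limit of \<open>finite_jtp\<close> each term acquires two factors 1/f and the
  finite product in front tends to f, which leaves one 1/f, where f =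
  \<open>ramanujan_f (- (q\<^sup>2))\<close>.\<close>

lemma jacobi_triple_product:
  "(\<lambda>N. \<Prod>k<N. (1 + z * q ^ (2*k+1)) * (1 + q ^ (2*k+1) / z))
     \<longlonglongrightarrow> (\<Sum>\<^sub>\<infinity>n. z powi n * q powi (n * n)) / ramanujan_f (- (q\<^sup>2))"
proof -
  let ?f = "ramanujan_f (- (q\<^sup>2))"
  obtain C where C: "\<And>N n. norm (jtp_term N n) \<le> C * norm (z powi n * q powi (n * n))"
    using jtp_term_bound by blast
  have f0: "?f \<noteq> 0" using q2(1) by (rule ramanujan_f_nonzero)
  have "(\<lambda>N. infsum (jtp_term N) UNIV) \<longlonglongrightarrow> (\<Sum>\<^sub>\<infinity>n. inverse ?f * inverse ?f * (z powi n * q powi (n * n)))"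
  proof (rule infsum_dominated_convergence[OF _ C])
    show "(\<lambda>N. jtp_term N n) \<longlonglongrightarrow> inverse ?f * inverse ?f * (z powi n * q powi (n * n))" for n
      unfolding jtp_term_def diff_conv_add_uminus[of "int _"]
      by (intro tendsto_mult inv_qpoch_LIMSEQ q2 tendsto_const)
    show "(\<lambda>n. C * norm (z powi n * q powi (n * n))) summable_on UNIV"
      by (rule summable_on_cmult_right[OF abs_summable_theta[OF q z]])
  qed
  moreover have "(\<lambda>N. \<Prod>k<2*N. 1 - (q\<^sup>2) ^ Suc k) \<longlonglongrightarrow> ?f"
    using LIMSEQ_subseq_LIMSEQ[OF ramanujan_f_LIMSEQ[OF q2(1)], of "\<lambda>N. 2*N"]
    by (simp add: strict_mono_def o_def)
  ultimately have "(\<lambda>N. (\<Prod>k<2*N. 1 - (q\<^sup>2) ^ Suc k) * infsum (jtp_term N) UNIV)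
      \<longlonglongrightarrow> ?f * (\<Sum>\<^sub>\<infinity>n. inverse ?f * inverse ?f * (z powi n * q powi (n * n)))"
    by (rule tendsto_mult[rotated])
  moreover have "?f * (inverse ?f * inverse ?f * S) = S / ?f" for S
    using f0 by (simp add: field_simps)
  ultimately show ?thesis
    unfolding finite_jtp infsum_cmult_right' by simp
qed

end

text \<open>The case z = -1 of the triple product is the square of the product of 1 - q^(2k+1);
  separating odd from even exponents shows that product to be f(-q)/f(-q^2), with q = t^4.\<close>

lemma theta4_eq:
  assumes "norm t < 1" "t \<noteq> 0"
  shows "theta4 t = ramanujan_f (- (t^4)) ^ 2 / ramanujan_f (- (t^8))"
proof -
  define q where "q = t ^ 4"
  have q: "norm q < 1" "q \<noteq> 0" using assms by (auto simp: q_def norm_power power_less_one_iff)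
  note q2 = norm_power2_less_one[OF q]
  note nz = ramanujan_f_nonzero[OF q2(1)]
  have lim: "(\<lambda>N. (\<Prod>k<2*N. 1 - q ^ Suc k) / (\<Prod>k<N. 1 - (q\<^sup>2) ^ Suc k)) \<longlonglongrightarrow> ramanujan_f (- q) / ramanujan_f (- (q\<^sup>2))"
  proof (rule tendsto_divide[OF _ ramanujan_f_LIMSEQ[OF q2(1)] nz])
    show "(\<lambda>N. \<Prod>k<2*N. 1 - q ^ Suc k) \<longlonglongrightarrow> ramanujan_f (- q)"
      using LIMSEQ_subseq_LIMSEQ[OF ramanujan_f_LIMSEQ[OF q(1)], of "\<lambda>N. 2*N"]
      by (simp add: strict_mono_def o_def)
  qed
  have split: "(\<Prod>k<2*N. 1 - q ^ Suc k) = (\<Prod>k<N. 1 - (q\<^sup>2) ^ Suc k) * (\<Prod>k<N. 1 - q ^ (2*k+1))" for N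
  proof (induction N)
    case (Suc N)
    have "(q\<^sup>2) ^ Suc N = q ^ Suc (Suc (2*N))" by (simp only: power_mult[symmetric]) simp
    then show ?case
      by (simp only: mult_Suc_right add_2_eq_Suc prod.lessThan_Suc Suc.IH) (simp add: mult_ac)
  qed simp
  have "(\<Prod>k<N. 1 - (q\<^sup>2) ^ Suc k) \<noteq> 0" for N
    unfolding prod_zero_iff[OF finite_lessThan] using one_minus_power_Suc_nonzero[OF q2(1)] by blast
  then have "(\<lambda>N. \<Prod>k<N. 1 - q ^ (2*k+1)) \<longlonglongrightarrow> ramanujan_f (- q) / ramanujan_f (- (q\<^sup>2))"
    using lim unfolding split by (simp only: nonzero_mult_div_cancel_left not_False_eq_True)
  then have "(\<lambda>N. (\<Prod>k<N. 1 - q ^ (2*k+1)) * (\<Prod>k<N. 1 - q ^ (2*k+1))) \<longlonglongrightarrow> (ramanujan_f (- q) / ramanujan_f (- (q\<^sup>2)))\<^sup>2"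
    unfolding power2_eq_square by (intro tendsto_mult)
  moreover have "(\<lambda>N. (\<Prod>k<N. 1 - q ^ (2*k+1)) * (\<Prod>k<N. 1 - q ^ (2*k+1)))
      \<longlonglongrightarrow> (\<Sum>\<^sub>\<infinity>n. (-1) powi n * q powi (n * n)) / ramanujan_f (- (q\<^sup>2))"
    using jacobi_triple_product[OF q, of "-1"] by (simp add: prod.distrib)
  ultimately have "(ramanujan_f (- q) / ramanujan_f (- (q\<^sup>2)))\<^sup>2 = (\<Sum>\<^sub>\<infinity>n. (-1) powi n * q powi (n * n)) / ramanujan_f (- (q\<^sup>2))"
    by (rule LIMSEQ_unique)
  then have "(\<Sum>\<^sub>\<infinity>n. (-1) powi n * q powi (n * n)) = (ramanujan_f (- q))\<^sup>2 / ramanujan_f (- (q\<^sup>2))"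
    using nz by (simp add: field_simps power2_eq_square)
  moreover have "(-1) powi n = (if even n then 1 else -1 :: complex)" for n :: int
    by (simp add: power_int_minus_left)
  moreover have "q\<^sup>2 = t ^ 8" by (simp add: q_def)
  ultimately show ?thesis
    unfolding theta4_def theta_jacobi[OF assms(2)] q_def[symmetric] by (simp only:)
qed

text \<open>The case z = q of the triple product has factors (1 + q^(2k+2))(1 + q^(2k)), and 1 + a =
  (1 - a^2)/(1 - a) turns each into a quotient of Euler factors.\<close>

lemma theta2_eq:
  assumes "norm t < 1" "t \<noteq> 0"
  shows "theta2 t = 2 * t * ramanujan_f (- (t^16)) ^ 2 / ramanujan_f (- (t^8))"
proof -
  define q where "q = t ^ 4"
  have q: "norm q < 1" "q \<noteq> 0" using assms by (auto simp: q_def norm_power power_less_one_iff)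
  note q2 = norm_power2_less_one[OF q] and q4 = norm_power2_less_one[OF norm_power2_less_one[OF q]]
  note nz = ramanujan_f_nonzero[OF q2(1)]
  let ?e = "ramanujan_f (- ((q\<^sup>2)\<^sup>2)) / ramanujan_f (- (q\<^sup>2))"
  have split: "(\<Prod>k<N. 1 - ((q\<^sup>2)\<^sup>2) ^ Suc k) = (\<Prod>k<N. 1 - (q\<^sup>2) ^ Suc k) * (\<Prod>k<N. 1 + (q\<^sup>2) ^ Suc k)" for N
  proof (unfold prod.distrib[symmetric], intro prod.cong refl)
    fix k
    have "((q\<^sup>2)\<^sup>2) ^ Suc k = (q\<^sup>2) ^ Suc k * (q\<^sup>2) ^ Suc k" by (simp only: power_mult_distrib[symmetric] power2_eq_square)
    moreover have "1 - a * a = (1 - a) * (1 + a)" for a :: complex by (simp add: algebra_simps)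
    ultimately show "1 - ((q\<^sup>2)\<^sup>2) ^ Suc k = (1 - (q\<^sup>2) ^ Suc k) * (1 + (q\<^sup>2) ^ Suc k)" by (simp only:)
  qed
  have lim: "(\<lambda>N. (\<Prod>k<N. 1 - ((q\<^sup>2)\<^sup>2) ^ Suc k) / (\<Prod>k<N. 1 - (q\<^sup>2) ^ Suc k)) \<longlonglongrightarrow> ?e"
    by (intro tendsto_divide ramanujan_f_LIMSEQ q2 q4 nz)
  have "(\<Prod>k<N. 1 - (q\<^sup>2) ^ Suc k) \<noteq> 0" for N
    unfolding prod_zero_iff[OF finite_lessThan] using one_minus_power_Suc_nonzero[OF q2(1)] by blast
  then have e: "(\<lambda>N. \<Prod>k<N. 1 + (q\<^sup>2) ^ Suc k) \<longlonglongrightarrow> ?e"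
    using lim unfolding split by (simp only: nonzero_mult_div_cancel_left not_False_eq_True)
  \<comment> \<open>The extra factor at k = 0 is 1 + 1; it is the source of the 2 in the
    formula.\<close>
  have e': "(\<lambda>N. \<Prod>k<N. 1 + (q\<^sup>2) ^ k) \<longlonglongrightarrow> 2 * ?e"
  proof -
    have "(\<Prod>k<Suc N. 1 + (q\<^sup>2) ^ k) = 2 * (\<Prod>k<N. 1 + (q\<^sup>2) ^ Suc k)" for N
      by (subst prod.lessThan_Suc_shift) simp
    then have "(\<lambda>N. \<Prod>k<Suc N. 1 + (q\<^sup>2) ^ k) \<longlonglongrightarrow> 2 * ?e"
      by (simp only:) (intro tendsto_mult e tendsto_const)
    then show ?thesis by (rule LIMSEQ_imp_Suc)
  qed
  have "(\<lambda>N. (\<Prod>k<N. 1 + (q\<^sup>2) ^ Suc k) * (\<Prod>k<N. 1 + (q\<^sup>2) ^ k)) \<longlonglongrightarrow> ?e * (2 * ?e)"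
    by (intro tendsto_mult e e')
  moreover have "(\<lambda>N. (\<Prod>k<N. 1 + (q\<^sup>2) ^ Suc k) * (\<Prod>k<N. 1 + (q\<^sup>2) ^ k))
      \<longlonglongrightarrow> (\<Sum>\<^sub>\<infinity>n. q powi n * q powi (n * n)) / ramanujan_f (- (q\<^sup>2))"
  proof -
    have "(1 + q * q ^ (2*k+1)) * (1 + q ^ (2*k+1) / q) = (1 + (q\<^sup>2) ^ Suc k) * (1 + (q\<^sup>2) ^ k)" for k
      using q(2) by (simp add: power_mult power_add power2_eq_square)
    then show ?thesis
      using jacobi_triple_product[OF q q(2)] by (simp only: prod.distrib)
  qed
  ultimately have "?e * (2 * ?e) = (\<Sum>\<^sub>\<infinity>n. q powi n * q powi (n * n)) / ramanujan_f (- (q\<^sup>2))"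
    by (rule LIMSEQ_unique)
  then have "(\<Sum>\<^sub>\<infinity>n. q powi n * q powi (n * n)) = 2 * (ramanujan_f (- ((q\<^sup>2)\<^sup>2)))\<^sup>2 / ramanujan_f (- (q\<^sup>2))"
    using nz by (simp add: field_simps power2_eq_square)
  moreover have "q\<^sup>2 = t ^ 8" "(t ^ 8)\<^sup>2 = t ^ 16" by (simp_all add: q_def)
  ultimately show ?thesis
    unfolding theta2_def theta_jacobi[OF assms(2)] infsum_cmult_right' q_def[symmetric]
    by (simp only: times_divide_eq_right mult_ac)
qed

section \<open>Modular equations\<close>

text \<open>With q = r^8 this is P, the quotient of Dedekind eta functions at tau and 4 tau. As a
  function of r it is single-valued, and r^3 and r^9 give R and Q.\<close>

definition eta_quot :: "complex \<Rightarrow> complex" where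
  "eta_quot r = ramanujan_f (- (r ^ 8)) / (r * ramanujan_f (- (r ^ 32)))"

lemma eta_quot_square:
  assumes "norm r < 1" "r \<noteq> 0"
  shows "eta_quot r ^ 2 = 2 * theta4 (r\<^sup>2) / theta2 (r\<^sup>2)" "theta2 (r\<^sup>2) \<noteq> 0"
proof -
  note r2 = norm_power2_less_one[OF assms]
  have p: "norm (r ^ Suc k) < 1" for k
    using assms by (simp only: norm_power norm_ge_zero power_less_one_iff zero_less_Suc)
  have nz: "ramanujan_f (- (r ^ 16)) \<noteq> 0" "ramanujan_f (- (r ^ 32)) \<noteq> 0"
    using ramanujan_f_nonzero[OF p[of 15]] ramanujan_f_nonzero[OF p[of 31]] by simp_all
  have t4: "theta4 (r\<^sup>2) = ramanujan_f (- (r^8)) ^ 2 / ramanujan_f (- (r^16))"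
    using theta4_eq[OF r2] by simp
  have t2: "theta2 (r\<^sup>2) = 2 * r\<^sup>2 * ramanujan_f (- (r^32)) ^ 2 / ramanujan_f (- (r^16))"
    using theta2_eq[OF r2] by simp
  show "eta_quot r ^ 2 = 2 * theta4 (r\<^sup>2) / theta2 (r\<^sup>2)"
    unfolding t4 t2 eta_quot_def using nz assms(2) by (simp add: field_simps)
  show "theta2 (r\<^sup>2) \<noteq> 0" unfolding t2 using nz assms(2) by simp
qed

text \<open>With u and v the ratios theta4/theta2 at t and t^3, eliminating theta3 gives (1 + u v)^4
  = (1 + u^4)(1 + v^4). Since u and v determine only P^2 and R^2, the result is the square of the
  wanted equation.\<close>

lemma cubic_modular_squared:
  assumes r: "norm r < 1" "r \<noteq> 0"
  defines "P \<equiv> eta_quot r" and "R \<equiv> eta_quot (r ^ 3)"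
  shows "(P ^ 4 + R ^ 4)\<^sup>2 = (P ^ 3 * R ^ 3 + 4 * P * R)\<^sup>2"
proof -
  have r3: "norm (r ^ 3) < 1" "r ^ 3 \<noteq> 0"
    using r by (simp_all add: norm_power power_less_one_iff)
  define t where "t = r\<^sup>2"
  have t: "norm t < 1" "t \<noteq> 0" unfolding t_def using norm_power2_less_one[OF r] by auto
  have t3: "norm (t ^ 3) < 1" "t ^ 3 \<noteq> 0"
    using t by (simp_all add: norm_power power_less_one_iff)
  have r3t: "(r ^ 3)\<^sup>2 = t ^ 3" by (simp add: t_def)
  define u v where "u = theta4 t / theta2 t" and "v = theta4 (t^3) / theta2 (t^3)"
  have P2: "P\<^sup>2 = 2 * u" and R2: "R\<^sup>2 = 2 * v"
    using eta_quot_square(1)[OF r] eta_quot_square(1)[OF r3] unfolding P_def R_def r3t u_def v_def t_def by simp_all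
  have nz: "theta2 t \<noteq> 0" "theta2 (t^3) \<noteq> 0"
    using eta_quot_square(2)[OF r] eta_quot_square(2)[OF r3] unfolding r3t t_def by simp_all
  have t4: "theta4 t = u * theta2 t" "theta4 (t^3) = v * theta2 (t^3)"
    using nz by (simp_all add: u_def v_def)
  have "(theta3 t * theta3 (t^3)) ^ 4 = (theta2 t * theta2 (t^3)) ^ 4 * (1 + u * v) ^ 4"
    unfolding theta_cubic[OF t] t4 power_mult_distrib[symmetric] by (simp add: algebra_simps)
  moreover have "(theta3 t * theta3 (t^3)) ^ 4 = (theta2 t * theta2 (t^3)) ^ 4 * ((1 + u ^ 4) * (1 + v ^ 4))"
    unfolding power_mult_distrib theta_quartic[OF t] theta_quartic[OF t3] t4 by (simp add: algebra_simps)
  ultimately have "(1 + u * v) ^ 4 = (1 + u ^ 4) * (1 + v ^ 4)" using nz by simp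
  then have "16 * (u ^ 4 + v ^ 4) = 16 * (4 * u * v + 6 * u\<^sup>2 * v\<^sup>2 + 4 * u ^ 3 * v ^ 3)"
    by (simp add: eval_nat_numeral algebra_simps)
  moreover have "(P ^ 4 + R ^ 4)\<^sup>2 = (P\<^sup>2) ^ 4 + (R\<^sup>2) ^ 4 + 2 * ((P\<^sup>2)\<^sup>2 * (R\<^sup>2)\<^sup>2)"
    by (simp add: power2_eq_square power4_eq_xxxx algebra_simps)
  moreover have "(P ^ 3 * R ^ 3 + 4 * P * R)\<^sup>2 = (P\<^sup>2) ^ 3 * (R\<^sup>2) ^ 3 + 8 * ((P\<^sup>2)\<^sup>2 * (R\<^sup>2)\<^sup>2) + 16 * (P\<^sup>2 * R\<^sup>2)"
    by (simp add: power2_eq_square power3_eq_cube algebra_simps)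
  ultimately show ?thesis
    unfolding P2 R2 by (simp add: power_mult_distrib algebra_simps)
qed

section \<open>Analytic behaviour near the origin and the choice of sign\<close>

text \<open>The partial products converge uniformly on a closed disc about x that reaches half way
  to the unit circle, by comparison with a geometric series.\<close>

lemma ramanujan_f_holomorphic: "(\<lambda>x. ramanujan_f (- x)) holomorphic_on ball 0 1"
proof (rule holomorphic_uniform_sequence)
  show "(\<lambda>x. \<Prod>k<n. 1 - x ^ Suc k) holomorphic_on ball 0 1" for n
    by (intro holomorphic_intros)
  fix x :: complex assume x: "x \<in> ball 0 1"
  define d where "d = (1 - norm x) / 2"
  define K where "K = cball x d"
  have d: "d > 0" "norm x + d < 1" using x by (auto simp: d_def field_simps)
  have K: "norm y \<le> norm x + d" if "y \<in> K" for y
    using that norm_triangle_sub[of y x] by (simp add: K_def dist_norm norm_minus_commute)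
  have "K \<subseteq> ball 0 1" using K d(2) by fastforce
  moreover have "uniform_limit K (\<lambda>n x. \<Prod>k<n. 1 - x ^ Suc k) (\<lambda>x. ramanujan_f (- x)) sequentially"
  proof -
    have "uniformly_convergent_on K (\<lambda>N y. \<Sum>n<N. norm ((1 - y ^ Suc n) - 1))"
    proof (rule Weierstrass_m_test')
      show "norm (norm ((1 - y ^ Suc n) - 1)) \<le> (norm x + d) ^ Suc n" if "y \<in> K" for n y
        using power_mono[OF K[OF that], of "Suc n"] by (simp add: norm_power norm_mult)
      show "summable (\<lambda>n. (norm x + d) ^ Suc n)"
        using d by (subst summable_Suc_iff) (simp add: summable_geometric)
    qed
    then have "uniformly_convergent_on K (\<lambda>N y. \<Prod>n<N. 1 - y ^ Suc n)"
      by (intro Infinite_Products.uniformly_convergent_on_prod') (auto simp: K_def intro!: continuous_intros)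
    then have "uniform_limit K (\<lambda>n x. \<Prod>k<n. 1 - x ^ Suc k) (\<lambda>x. lim (\<lambda>n. \<Prod>k<n. 1 - x ^ Suc k)) sequentially"
      by (simp only: uniformly_convergent_uniform_limit_iff)
    moreover have "lim (\<lambda>n. \<Prod>k<n. 1 - y ^ Suc k) = ramanujan_f (- y)" if "y \<in> K" for y
      using K[OF that] d(2) by (intro limI ramanujan_f_LIMSEQ) simp
    ultimately show ?thesis
      by (subst uniform_limit_cong'[symmetric, where f = "\<lambda>n x. \<Prod>k<n. 1 - x ^ Suc k"]) auto
  qed
  ultimately show "\<exists>d>0. cball x d \<subseteq> ball 0 1 \<and>
      uniform_limit (cball x d) (\<lambda>n x. \<Prod>k<n. 1 - x ^ Suc k) (\<lambda>x. ramanujan_f (- x)) sequentially"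
    using d(1) unfolding K_def by blast
qed simp

lemma tendsto_ramanujan_f_power:
  assumes "n > 0"
  shows "((\<lambda>r. ramanujan_f (- (r ^ n))) \<longlongrightarrow> 1) (at 0)"
proof -
  have "isCont (\<lambda>x. ramanujan_f (- x)) (0 ^ n)"
    using holomorphic_on_imp_continuous_on[OF ramanujan_f_holomorphic] assms
    by (simp add: continuous_on_eq_continuous_at power_0_left)
  then have "isCont (\<lambda>r. ramanujan_f (- (r ^ n))) 0"
    by (rule isCont_o2[rotated]) simp
  moreover have "ramanujan_f 0 = 1"
    using ramanujan_f_uminus[of 0] by simp
  ultimately show ?thesis
    using assms by (simp add: isCont_def power_0_left)
qed

lemma eta_quot_holomorphic:
  assumes "n > 0"
  shows "(\<lambda>r. eta_quot (r ^ n)) holomorphic_on ball 0 1 - {0}"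
proof -
  have hol: "(\<lambda>r. ramanujan_f (- (r ^ m))) holomorphic_on ball 0 1 - {0}" if "m > 0" for m
    by (rule holomorphic_on_compose_gen[OF _ ramanujan_f_holomorphic, unfolded o_def])
       (use that in \<open>auto intro!: holomorphic_intros simp: norm_power power_less_one_iff\<close>)
  show ?thesis
    unfolding eta_quot_def power_mult[symmetric]
    using assms by (intro holomorphic_intros hol)
      (auto intro!: ramanujan_f_nonzero simp: norm_power power_less_one_iff)
qed

lemma eta_quot_nonzero:
  assumes "norm r < 1" "r \<noteq> 0"
  shows "eta_quot r \<noteq> 0"
proof -
  have "norm (r ^ 8) < 1" "norm (r ^ 32) < 1"
    using assms by (simp_all add: norm_power power_less_one_iff)
  then show ?thesis
    using assms ramanujan_f_nonzero by (simp add: eta_quot_def)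
qed

text \<open>The leading coefficient at the pole; all nonvanishing claims near 0 below come from
  it.\<close>

lemma tendsto_eta_quot:
  assumes "n > 0"
  shows "((\<lambda>r. r ^ n * eta_quot (r ^ n)) \<longlongrightarrow> 1) (at 0)"
proof -
  have "((\<lambda>r. ramanujan_f (- (r ^ (n * 8))) / ramanujan_f (- (r ^ (n * 32)))) \<longlongrightarrow> 1 / 1) (at 0)"
    using assms by (intro tendsto_divide tendsto_ramanujan_f_power) auto
  moreover have "\<forall>\<^sub>F r in at 0. ramanujan_f (- (r ^ (n * 8))) / ramanujan_f (- (r ^ (n * 32))) = r ^ n * eta_quot (r ^ n)"
    by (auto simp: eventually_at_filter eta_quot_def power_mult)
  ultimately show ?thesis by (simp add: Lim_transform_eventually)
qed

lemma eventually_nonzero_punctured: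
  fixes f :: "complex \<Rightarrow> complex"
  assumes "((\<lambda>r. r ^ n * f r) \<longlongrightarrow> c) (at 0)" "c \<noteq> 0"
  shows "\<forall>\<^sub>F r in at 0. f r \<noteq> 0"
  using tendsto_imp_eventually_ne[OF assms] by eventually_elim auto

lemma eventually_cubic_modular:
  "\<forall>\<^sub>F r in at 0. eta_quot r ^ 4 + eta_quot (r ^ 3) ^ 4
     = eta_quot r ^ 3 * eta_quot (r ^ 3) ^ 3 + 4 * eta_quot r * eta_quot (r ^ 3)"
proof -
  let ?P = "\<lambda>r. eta_quot r" and ?R = "\<lambda>r. eta_quot (r ^ 3)"
  have p: "((\<lambda>r. r * ?P r) \<longlongrightarrow> 1) (at 0)" using tendsto_eta_quot[of 1] by simp
  have r: "((\<lambda>r. r ^ 3 * ?R r) \<longlongrightarrow> 1) (at 0)" using tendsto_eta_quot[of 3] by simp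
  \<comment> \<open>The squared equation leaves two signs. At the wrong one the sum of both sides
    would vanish, but its terms R^4 and P^3 R^3 both behave like r^(-12), so r^12 times the sum
    tends to 2.\<close>
  have "((\<lambda>r. r ^ 8 * (r * ?P r) ^ 4 + (r ^ 3 * ?R r) ^ 4 + (r * ?P r) ^ 3 * (r ^ 3 * ?R r) ^ 3
       + 4 * r ^ 8 * (r * ?P r) * (r ^ 3 * ?R r)) \<longlongrightarrow> 0 ^ 8 * 1 ^ 4 + 1 ^ 4 + 1 ^ 3 * 1 ^ 3 + 4 * 0 ^ 8 * 1 * 1) (at 0)"
    by (intro tendsto_intros p r)
  moreover have "(\<lambda>r. r ^ 8 * (r * ?P r) ^ 4 + (r ^ 3 * ?R r) ^ 4 + (r * ?P r) ^ 3 * (r ^ 3 * ?R r) ^ 3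
       + 4 * r ^ 8 * (r * ?P r) * (r ^ 3 * ?R r))
    = (\<lambda>r. r ^ 12 * (?P r ^ 4 + ?R r ^ 4 + (?P r ^ 3 * ?R r ^ 3 + 4 * ?P r * ?R r)))"
    by (simp add: fun_eq_iff power_mult_distrib power_mult[symmetric] algebra_simps)
       (simp add: eval_nat_numeral)
  ultimately have "((\<lambda>r. r ^ 12 * (?P r ^ 4 + ?R r ^ 4 + (?P r ^ 3 * ?R r ^ 3 + 4 * ?P r * ?R r))) \<longlongrightarrow> 2) (at 0)"
    by simp
  then have "\<forall>\<^sub>F r in at 0. ?P r ^ 4 + ?R r ^ 4 + (?P r ^ 3 * ?R r ^ 3 + 4 * ?P r * ?R r) \<noteq> 0"
    by (rule eventually_nonzero_punctured) simp
  moreover have "\<forall>\<^sub>F r in at 0. r \<in> ball 0 1 - {0::complex}"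
    by (rule eventually_at_in_open) auto
  ultimately show ?thesis
  proof eventually_elim
    case (elim r)
    then have "(?P r ^ 4 + ?R r ^ 4)\<^sup>2 = (?P r ^ 3 * ?R r ^ 3 + 4 * ?P r * ?R r)\<^sup>2"
      by (intro cubic_modular_squared) auto
    with elim(1) show ?case
      by (auto simp: power2_eq_iff)
  qed
qed

section \<open>The modular equation of degree 9\<close>

text \<open>
  \<open>P\<close> and \<open>Q\<close> are roots of the same quartic over \<open>R\<close>. Dividing two combinations of the two equations
  by \<open>P - Q\<close> gives a cubic and then a quadratic in \<open>R\<close> whose coefficients depend only on \<open>P + Q\<close> and
  \<open>P Q\<close>; their resultant is the claim times \<open>16 (h + 1)\<close> and a power of \<open>P Q\<close>.
\<close>

lemma nonic_algebra:
  fixes P Q R h :: complex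
  assumes PR: "P ^ 4 + R ^ 4 = P ^ 3 * R ^ 3 + 4 * P * R"
    and RQ: "R ^ 4 + Q ^ 4 = R ^ 3 * Q ^ 3 + 4 * R * Q"
    and nz: "P \<noteq> 0" "Q \<noteq> 0" and PQ: "P \<noteq> Q" and K: "P\<^sup>2 + P * Q + Q\<^sup>2 \<noteq> 0"
    and h: "h = P / Q + Q / P"
  shows "(P ^ 4 * Q ^ 4 + 256 / (P ^ 4 * Q ^ 4)) * (h + 1)
       = h ^ 6 - 8 * h ^ 5 + 4 * h ^ 4 + 64 * h ^ 3 - 16 * h ^ 2 - 160 * h - 96"
proof -
  define s e where "s = P * Q" and "e = P + Q"
  have s0: "s \<noteq> 0" using nz by (simp add: s_def)
  have sh: "s * h = P\<^sup>2 + Q\<^sup>2" using nz by (simp add: s_def h field_simps power2_eq_square)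
  \<comment> \<open>Needed at the end, where h + 1 is cancelled from the resultant.\<close>
  have h1: "h + 1 \<noteq> 0"
  proof
    assume "h + 1 = 0"
    then have "s * (h + 1) = 0" by simp
    then show False using K sh by (simp add: s_def algebra_simps)
  qed
  have e2: "e\<^sup>2 = s * (h + 2)"
    using sh by (simp add: e_def s_def power2_eq_square algebra_simps)
  \<comment> \<open>Subtracting the two equations eliminates R^4.\<close>
  have E1: "s * (h + 1) * R ^ 3 + 4 * R = e * (s * h)"
  proof -
    have "(P - Q) * ((P\<^sup>2 + Q\<^sup>2 + P * Q) * R ^ 3 + 4 * R - (P + Q) * (P\<^sup>2 + Q\<^sup>2)) = 0"
    proof -
      have "(P - Q) * ((P\<^sup>2 + Q\<^sup>2 + P * Q) * R ^ 3 + 4 * R - (P + Q) * (P\<^sup>2 + Q\<^sup>2))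
        = (R ^ 4 + Q ^ 4 - (R ^ 3 * Q ^ 3 + 4 * R * Q)) - (P ^ 4 + R ^ 4 - (P ^ 3 * R ^ 3 + 4 * P * R))"
        by (simp add: eval_nat_numeral algebra_simps)
      then show ?thesis using PR RQ by simp
    qed
    then have "(P\<^sup>2 + Q\<^sup>2 + P * Q) * R ^ 3 + 4 * R = (P + Q) * (P\<^sup>2 + Q\<^sup>2)"
      using PQ by (metis mult_eq_0_iff right_minus_eq)
    moreover have "s * (h + 1) = P\<^sup>2 + Q\<^sup>2 + P * Q" using sh by (simp add: distrib_left s_def)
    ultimately show ?thesis by (simp only: sh e_def)
  qed
  \<comment> \<open>Weighting the equations by P^3 and Q^3 eliminates R^3 instead; \<open>E1\<close>
    times R then lowers R^4 to a quadratic.\<close>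
  have E2: "4 * R\<^sup>2 = e * s * (h - 4) * R - s ^ 3"
  proof -
    have "(P - Q) * (R ^ 4 * (P\<^sup>2 + Q\<^sup>2 + P * Q) - 4 * P * Q * R * (P + Q) - P ^ 3 * Q ^ 3) = 0"
    proof -
      have "(P - Q) * (R ^ 4 * (P\<^sup>2 + Q\<^sup>2 + P * Q) - 4 * P * Q * R * (P + Q) - P ^ 3 * Q ^ 3)
        = P ^ 3 * (R ^ 4 + Q ^ 4 - (R ^ 3 * Q ^ 3 + 4 * R * Q)) - Q ^ 3 * (P ^ 4 + R ^ 4 - (P ^ 3 * R ^ 3 + 4 * P * R))"
        by (simp add: eval_nat_numeral algebra_simps)
      then show ?thesis using PR RQ by simp
    qed
    then have "R ^ 4 * (P\<^sup>2 + Q\<^sup>2 + P * Q) - 4 * P * Q * R * (P + Q) - P ^ 3 * Q ^ 3 = 0"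
      using PQ by (metis mult_eq_0_iff right_minus_eq)
    moreover have "s * h + s = P\<^sup>2 + Q\<^sup>2 + P * Q" using sh by (simp add: s_def)
    ultimately have "R ^ 4 * (s * h + s) - 4 * s * R * e - s ^ 3 = 0"
      by (simp only: e_def s_def power_mult_distrib mult_ac)
    moreover have "R ^ 4 * (s * h + s) = R * (e * (s * h) - 4 * R)"
      unfolding E1[symmetric] by (simp add: eval_nat_numeral algebra_simps)
    ultimately show ?thesis by (simp add: eval_nat_numeral algebra_simps)
  qed
  define x where "x = s ^ 4"
  define c where "c = 16 * h + x * (h + 1) * (h - 4)"
  define d where "d = x * (h + 1) * (h ^ 3 - 6 * h\<^sup>2 + 28) + 64"
  \<comment> \<open>Reducing the cubic \<open>E1\<close> modulo the quadratic \<open>E2\<close>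
    leaves a linear equation in R; c and d collect its coefficients.\<close>
  have lin: "d * R = e * s * c"
  proof -
    define M where "M = e * s * (h - 4)"
    have M2: "M\<^sup>2 = s ^ 3 * (h + 2) * (h - 4)\<^sup>2"
      by (simp add: M_def power_mult_distrib e2) (simp add: eval_nat_numeral)
    have "4 * R ^ 3 = M * R\<^sup>2 - s ^ 3 * R"
      using arg_cong[OF E2, of "\<lambda>v. R * v"] by (simp add: M_def eval_nat_numeral algebra_simps)
    from arg_cong[OF this, of "\<lambda>v. 4 * v"]
    have "16 * R ^ 3 = M * (4 * R\<^sup>2) - 4 * s ^ 3 * R" by (simp add: algebra_simps)
    also have "\<dots> = (M\<^sup>2 - 4 * s ^ 3) * R - M * s ^ 3"
      unfolding E2 M_def[symmetric] by (simp add: power2_eq_square algebra_simps)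
    finally have R3: "16 * R ^ 3 = (M\<^sup>2 - 4 * s ^ 3) * R - M * s ^ 3" .
    have "s * (h + 1) * (16 * R ^ 3) + 64 * R = 16 * (e * (s * h))"
      unfolding E1[symmetric] by (simp add: algebra_simps)
    then show ?thesis
      unfolding R3 M2 by (simp add: M_def c_def d_def x_def eval_nat_numeral algebra_simps)
  qed
  \<comment> \<open>Multiplying \<open>E2\<close> by d^2 before inserting \<open>lin\<close> avoids
    a division by d. Only e^2 survives, and \<open>e2\<close> expresses it through s and h.\<close>
  have "s ^ 3 * ((h + 2) * (4 * c\<^sup>2 - (h - 4) * c * d) + d\<^sup>2) = 0"
  proof -
    have "4 * (d * R)\<^sup>2 = d\<^sup>2 * (4 * R\<^sup>2)" by (simp add: power_mult_distrib)
    also have "\<dots> = d * (e * s * (h - 4)) * (d * R) - s ^ 3 * d\<^sup>2"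
      unfolding E2 by (simp add: power2_eq_square algebra_simps)
    finally have "4 * (e\<^sup>2 * s\<^sup>2 * c\<^sup>2) = d * (h - 4) * (e\<^sup>2 * s\<^sup>2 * c) - s ^ 3 * d\<^sup>2"
      unfolding lin by (simp add: power2_eq_square mult_ac)
    then show ?thesis
      unfolding e2 by (simp add: eval_nat_numeral algebra_simps)
  qed
  then have "(h + 2) * (4 * c\<^sup>2 - (h - 4) * c * d) + d\<^sup>2 = 0" using s0 by simp
  moreover have "(h + 2) * (4 * c\<^sup>2 - (h - 4) * c * d) + d\<^sup>2
     = 16 * (h + 1) * ((h + 1) * (x\<^sup>2 + 256) - x * (h ^ 6 - 8 * h ^ 5 + 4 * h ^ 4 + 64 * h ^ 3 - 16 * h\<^sup>2 - 160 * h - 96))"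
    unfolding c_def d_def by (simp add: eval_nat_numeral algebra_simps)
  ultimately have "(h + 1) * (x\<^sup>2 + 256) = x * (h ^ 6 - 8 * h ^ 5 + 4 * h ^ 4 + 64 * h ^ 3 - 16 * h\<^sup>2 - 160 * h - 96)"
    using h1 by (metis mult_eq_0_iff right_minus_eq zero_neq_numeral)
  moreover have "x = P ^ 4 * Q ^ 4" "x \<noteq> 0" using s0 by (simp_all add: x_def s_def power_mult_distrib)
  moreover have "(x + 256 / x) * (h + 1) = (h + 1) * (x\<^sup>2 + 256) / x"
    using \<open>x \<noteq> 0\<close> by (simp add: field_simps power2_eq_square)
  ultimately show ?thesis by simp
qed

text \<open>Written as a difference of the two sides, so that the identity theorem applies to a
  single function of r.\<close>

definition nonic_residual :: "complex \<Rightarrow> complex \<Rightarrow> complex" where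
  "nonic_residual P Q = (let h = P / Q + Q / P in
     (P ^ 4 * Q ^ 4 + 256 / (P ^ 4 * Q ^ 4)) * (h + 1)
       - (h ^ 6 - 8 * h ^ 5 + 4 * h ^ 4 + 64 * h ^ 3 - 16 * h ^ 2 - 160 * h - 96))"

lemma eventually_nonic_modular:
  "\<forall>\<^sub>F r in at 0. nonic_residual (eta_quot r) (eta_quot (r ^ 9)) = 0"
proof -
  let ?P = "\<lambda>r. eta_quot r" and ?Q = "\<lambda>r. eta_quot (r ^ 9)"
  have p: "((\<lambda>r. r * ?P r) \<longlongrightarrow> 1) (at 0)" using tendsto_eta_quot[of 1] by simp
  have q: "((\<lambda>r. r ^ 9 * ?Q r) \<longlongrightarrow> 1) (at 0)" using tendsto_eta_quot[of 9] by simp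
  \<comment> \<open>Near 0, Q is of order r^(-9) and dominates P, of order r^(-1); this excludes P =
    Q here and P^2 + P Q + Q^2 = 0 below.\<close>
  have "((\<lambda>r. r ^ 8 * (r * ?P r) - r ^ 9 * ?Q r) \<longlongrightarrow> 0 ^ 8 * 1 - 1) (at 0)"
    by (intro tendsto_intros p q)
  then have "((\<lambda>r. r ^ 9 * (?P r - ?Q r)) \<longlongrightarrow> -1) (at 0)"
    by (simp add: algebra_simps eval_nat_numeral)
  then have 1: "\<forall>\<^sub>F r in at 0. ?P r - ?Q r \<noteq> 0"
    by (rule eventually_nonzero_punctured) simp
  have "((\<lambda>r. (r ^ 8 * (r * ?P r))\<^sup>2 + r ^ 8 * (r * ?P r) * (r ^ 9 * ?Q r) + (r ^ 9 * ?Q r)\<^sup>2)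
      \<longlongrightarrow> (0 ^ 8 * 1)\<^sup>2 + 0 ^ 8 * 1 * 1 + 1\<^sup>2) (at 0)"
    by (intro tendsto_intros p q)
  moreover have "(\<lambda>r. (r ^ 8 * (r * ?P r))\<^sup>2 + r ^ 8 * (r * ?P r) * (r ^ 9 * ?Q r) + (r ^ 9 * ?Q r)\<^sup>2)
    = (\<lambda>r. r ^ 18 * ((?P r)\<^sup>2 + ?P r * ?Q r + (?Q r)\<^sup>2))"
    by (simp add: fun_eq_iff algebra_simps eval_nat_numeral)
  ultimately have "((\<lambda>r. r ^ 18 * ((?P r)\<^sup>2 + ?P r * ?Q r + (?Q r)\<^sup>2)) \<longlongrightarrow> 1) (at 0)" by simp
  then have 2: "\<forall>\<^sub>F r in at 0. (?P r)\<^sup>2 + ?P r * ?Q r + (?Q r)\<^sup>2 \<noteq> 0"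
    by (rule eventually_nonzero_punctured) simp
  \<comment> \<open>Substituting r^3 for r turns the relation between P and R into the one between R
    and Q.\<close>
  have "filterlim (\<lambda>r::complex. r ^ 3) (at 0) (at 0)"
    by (rule filterlim_atI) (auto intro!: tendsto_eq_intros simp: eventually_at_filter)
  from eventually_compose_filterlim[OF eventually_cubic_modular this]
  have 3: "\<forall>\<^sub>F r in at 0. eta_quot (r ^ 3) ^ 4 + ?Q r ^ 4 = eta_quot (r ^ 3) ^ 3 * ?Q r ^ 3 + 4 * eta_quot (r ^ 3) * ?Q r"
    by (simp add: power_mult[symmetric])
  have 4: "\<forall>\<^sub>F r in at 0. r \<in> ball 0 1 - {0::complex}"
    by (rule eventually_at_in_open) auto
  show ?thesis using 1 2 3 4 eventually_cubic_modular
  proof eventually_elim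
    case (elim r)
    have "norm (r ^ 9) < 1" using elim(4) by (simp add: norm_power power_less_one_iff)
    then have "?P r \<noteq> 0" "?Q r \<noteq> 0" using elim(4) eta_quot_nonzero[of r] eta_quot_nonzero[of "r ^ 9"] by auto
    then show ?case
      unfolding nonic_residual_def Let_def using elim(1) by (intro right_minus_eq[THEN iffD2] nonic_algebra[OF elim(5,3) _ _ _ elim(2) refl]) auto
  qed
qed

lemma nonic_modular:
  assumes "norm r < 1" "r \<noteq> 0"
  shows "nonic_residual (eta_quot r) (eta_quot (r ^ 9)) = 0"
proof -
  define F where "F = (\<lambda>r. nonic_residual (eta_quot r) (eta_quot (r ^ 9)))"
  let ?S = "ball 0 1 - {0::complex}"
  have nz: "eta_quot r \<noteq> 0" "eta_quot (r ^ 9) \<noteq> 0" if "r \<in> ?S" for r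
    using that eta_quot_nonzero[of r] eta_quot_nonzero[of "r ^ 9"] by (auto simp: norm_power power_less_one_iff)
  have "\<forall>\<^sub>F r in at 0. r \<in> ?S" by (rule eventually_at_in_open) auto
  with eventually_nonic_modular have "\<forall>\<^sub>F r in at 0. F r = 0 \<and> r \<in> ?S"
    unfolding F_def by (rule eventually_conj)
  then obtain U where U: "open U" "0 \<in> U" "\<And>r. r \<in> U - {0} \<Longrightarrow> F r = 0 \<and> r \<in> ?S"
    by (auto simp: eventually_at_topological)
  have "F holomorphic_on ?S"
    unfolding F_def nonic_residual_def Let_def using nz eta_quot_holomorphic[of 1] eta_quot_holomorphic[of 9]
    by (intro holomorphic_intros) auto
  \<comment> \<open>The origin lies outside the domain, so the limit point of zeros for the identity
    theorem is taken inside the open set \<open>U - {0}\<close>.\<close>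
  moreover obtain \<xi> where "\<xi> \<in> U - {0}"
    using islimpt_UNIV[of 0] U(1,2) unfolding islimpt_def by blast
  moreover have "\<xi> islimpt (U - {0})"
    using calculation U by (intro interior_limit_point) (auto simp: interior_open open_delete)
  moreover have "connected ?S" by (rule connected_punctured_ball) simp
  ultimately have "F r = 0"
    using assms U(3) by (intro analytic_continuation[of F ?S "U - {0}" \<xi> r]) auto
  then show ?thesis by (simp add: F_def)
qed

theorem theorem3p3:
  fixes q r P Q h :: complex
  assumes "0 < norm q" and "norm q < 1"
    and "r ^ 8 = q"  (* r is the chosen value of q^(1/8) *)
    and "P = ramanujan_f (- q) / (r * ramanujan_f (- (q ^ 4)))"
    and "Q = ramanujan_f (- (q ^ 9)) / (r ^ 9 * ramanujan_f (- (q ^ 36)))"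
    and "h = P / Q + Q / P"
  shows "(P ^ 4 * Q ^ 4 + 256 / (P ^ 4 * Q ^ 4)) * (h + 1)
       = h ^ 6 - 8 * h ^ 5 + 4 * h ^ 4 + 64 * h ^ 3 - 16 * h ^ 2 - 160 * h - 96"
proof -
  have r: "norm r < 1" "r \<noteq> 0"
    using assms(1-3) by (auto simp: norm_power power_less_one_iff)
  have "P = eta_quot r" "Q = eta_quot (r ^ 9)"
    unfolding assms(4,5) assms(3)[symmetric] eta_quot_def by (simp_all add: power_mult[symmetric])
  then have "nonic_residual P Q = 0"
    using nonic_modular[OF r] by simp
  then show ?thesis
    unfolding nonic_residual_def Let_def assms(6)[symmetric] by (simp only: right_minus_eq)
qed

end
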